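(* Let $(G,+)$ be a torsion-free abelian group equipped with a total order $\preceq$ compatible with its group structure. Let $M$ and $N$ be two (loopless) matroids over $G$, both of the same rank $n\geq 1$. Assume that all of the following hold: (1) $E(M)$ and $E(N)$ are both positive; (2) $N$ is a sparse paving matroid; (3) $|E(M)|=|E(N)|=n+1$; (4) $x\preceq ny$, where $x=\max(E(M))$, $y=\min(E(N))$ and $ny=y+\cdots+y$ ($n$ summands). Then $M$ is matched to $N$.
   Context: A total order $\preceq$ on $G$ is compatible with the group structure if $a\preceq b$ implies $a+c\preceq b+c$ for all $a,b,c\in G$. A nonzero element $x$ is positive if $0\preceq x$; a subset is positive if all its elements are positive. A matroid over $G$ is a matroid whose ground set $E(M)$ is a finite subset of $G$. A matroid $M$ of rank $n$ is paving if all its circuits have size at least $n$, and sparse paving if both $M$ and its dual $M^*$ are paving. Matchings: let $M,N$ be matroids over $G$ with $r(M)=r(N)=n>0$. Ordered bases $\{a_1,\dots,a_n\}$ of $M$ and $\{b_1,\dots,b_n\}$ of $N$ are matched if $a_i+b_i\notin E(M)$ for all $1\le i\le n$. $M$ is matched to $N$ if for every basis of $M$ there exists a basis of $N$ (with a suitable ordering) to which it is matched. *)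

theory Defs
  imports Main
begin

text \<open>A matroid is given by its ground set and its family of independent sets.\<close>

record 'a set_system =
  ground :: "'a set"
  indeps :: "'a set set"

definition matroid :: "'a set_system \<Rightarrow> bool" where
  "matroid M \<longleftrightarrow>
     finite (ground M) \<and>
     indeps M \<subseteq> Pow (ground M) \<and>
     {} \<in> indeps M \<and>
     (\<forall>I \<in> indeps M. \<forall>J \<subseteq> I. J \<in> indeps M) \<and>
     (\<forall>I \<in> indeps M. \<forall>J \<in> indeps M. card I < card J \<longrightarrow>
        (\<exists>e \<in> J - I. insert e I \<in> indeps M))"

definition basis :: "'a set_system \<Rightarrow> 'a set \<Rightarrow> bool" where
  "basis M B \<longleftrightarrow> B \<in> indeps M \<and> (\<forall>I \<in> indeps M. B \<subseteq> I \<longrightarrow> I = B)"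

definition circuit :: "'a set_system \<Rightarrow> 'a set \<Rightarrow> bool" where
  "circuit M C \<longleftrightarrow> C \<subseteq> ground M \<and> C \<notin> indeps M \<and> (\<forall>D. D \<subset> C \<longrightarrow> D \<in> indeps M)"

definition matroid_rank :: "'a set_system \<Rightarrow> nat" where
  "matroid_rank M = Max (card ` indeps M)"

definition loopless :: "'a set_system \<Rightarrow> bool" where
  "loopless M \<longleftrightarrow> (\<forall>e \<in> ground M. \<not> circuit M {e})"

text \<open>The bases of the dual are the complements of the bases of \<open>M\<close>; its independent
  sets are the subsets of those.\<close>

definition dual_matroid :: "'a set_system \<Rightarrow> 'a set_system" where
  "dual_matroid M =
     \<lparr>ground = ground M, indeps = {I. \<exists>B. basis M B \<and> I \<subseteq> ground M - B}\<rparr>"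

definition paving :: "'a set_system \<Rightarrow> bool" where
  "paving M \<longleftrightarrow> (\<forall>C. circuit M C \<longrightarrow> matroid_rank M \<le> card C)"

definition sparse_paving :: "'a set_system \<Rightarrow> bool" where
  "sparse_paving M \<longleftrightarrow> paving M \<and> paving (dual_matroid M)"

definition nat_multiple :: "nat \<Rightarrow> 'a::ab_group_add \<Rightarrow> 'a" where
  "nat_multiple n y = (\<Sum>i = 1..n. y)"

text \<open>Every group in class \<open>linordered_ab_group_add\<close> is torsion-free; the notion is stated
  separately so that the hypothesis can appear explicitly.\<close>

definition torsion_free :: "'a::ab_group_add itself \<Rightarrow> bool" where
  "torsion_free TYPE('a) \<longleftrightarrow> (\<forall>(x::'a) n. x \<noteq> 0 \<longrightarrow> 0 < n \<longrightarrow> nat_multiple n x \<noteq> 0)"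

definition positive_set :: "'a::linordered_ab_group_add set \<Rightarrow> bool" where
  "positive_set A \<longleftrightarrow> (\<forall>x \<in> A. x \<noteq> 0 \<and> 0 \<le> x)"

text \<open>An ordering of a basis \<open>B\<close> is a bijection from \<open>{1..n}\<close> onto \<open>B\<close>, where \<open>n\<close> is the
  rank. The relation is meant for matroids of equal positive rank; it is not symmetric, since
  the sums have to avoid the ground set of \<open>M\<close>.\<close>

definition matched_bases ::
  "'a::ab_group_add set_system \<Rightarrow> nat \<Rightarrow> (nat \<Rightarrow> 'a) \<Rightarrow> (nat \<Rightarrow> 'a) \<Rightarrow> bool" where
  "matched_bases M n a b \<longleftrightarrow> (\<forall>i \<in> {1..n}. a i + b i \<notin> ground M)"

definition matched_to ::
  "'a::ab_group_add set_system \<Rightarrow> 'a set_system \<Rightarrow> bool" where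
  "matched_to M N \<longleftrightarrow>
     (\<forall>A. basis M A \<longrightarrow>
        (\<exists>B a b. basis N B \<and>
           bij_betw a {1..matroid_rank M} A \<and> bij_betw b {1..matroid_rank N} B \<and>
           matched_bases M (matroid_rank M) a b))"

end

theory Submission
  imports Defs
begin

text \<open>For a basis \<open>A\<close> of \<open>M\<close> and a basis \<open>B\<close> of \<open>N\<close>, join \<open>a \<in> A\<close> to \<open>b \<in> B\<close> when
  \<open>a + b \<notin> E(M)\<close>. If Hall's condition fails, there are \<open>S \<subseteq> A\<close> and \<open>U \<subseteq> B\<close>, both nonempty, with
  \<open>S + ({0} \<union> U) \<subseteq> E(M)\<close> and \<open>|S| + |U| \<ge> n + 1 = |E(M)|\<close>. A sumset in an ordered group has at least
  \<open>|S| + |{0} \<union> U| - 1\<close> elements, so equality holds. If \<open>|S| \<ge> 2\<close>, then \<open>E(M)\<close> is an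
  arithmetic progression with difference \<open>d = min U\<close>, hence \<open>max E(M) > n d \<ge> n min E(N)\<close>, which
  is excluded. If \<open>S = {s}\<close>, then \<open>U = B\<close> and \<open>E(M) = s + ({0} \<union> B)\<close>, which determines \<open>B\<close>.
  Since \<open>N\<close> is loopless and larger than its rank, it has two distinct bases, and at
  least one of them avoids this exceptional value.\<close>

section \<open>Hall's marriage theorem\<close>

text \<open>Induction on \<open>card A\<close>. If some nonempty proper subset has no more
  neighbours than elements, it is matched first and the rest avoids its neighbours. Otherwise Hall's
  condition is strict on all such subsets, and any single pair can be fixed.\<close>

theorem hall_marriage:
  assumes "finite A" and "\<And>a. a \<in> A \<Longrightarrow> finite (F a)"
    and "\<And>S. S \<subseteq> A \<Longrightarrow> card S \<le> card (\<Union> (F ` S))"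
  shows "\<exists>f. inj_on f A \<and> (\<forall>a\<in>A. f a \<in> F a)"
  using assms
proof (induction "card A" arbitrary: A F rule: less_induct)
  case less
  note fin = less.prems(1) and finF = less.prems(2) and hall = less.prems(3)
  have finU: "finite (\<Union> (F ` S))" if "S \<subseteq> A" for S
    using that fin finF by (meson finite_UN finite_subset subsetD)
  consider "A = {}"
    | (tight) S where "S \<subset> A" "S \<noteq> {}" "card (\<Union> (F ` S)) \<le> card S"
    | (slack) "A \<noteq> {}" "\<And>S. \<lbrakk>S \<subset> A; S \<noteq> {}\<rbrakk> \<Longrightarrow> card S < card (\<Union> (F ` S))"
    by (meson not_le)
  then show ?case
  proof cases
    case 1
    then show ?thesis by simp
  next
    case tight
    let ?V = "\<Union> (F ` S)"
    have SA: "S \<subseteq> A" and finS: "finite S"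
      using tight(1) fin finite_subset by auto
    have finV: "finite ?V" by (rule finU[OF SA])
    have "card S < card A"
      using tight(1) fin by (simp add: psubset_card_mono)
    then obtain f where f: "inj_on f S" "\<forall>a\<in>S. f a \<in> F a"
      using less.hyps[of S F] finS finF hall SA by (meson subset_trans subsetD)
    have "card (A - S) < card A"
      using tight fin SA by (intro psubset_card_mono) auto
    \<comment> \<open>Hall's condition survives on \<open>A - S\<close>: apply it to
      \<open>T \<union> S\<close> and discard \<open>?V\<close>, which has at most
      \<open>card S\<close> elements.\<close>
    moreover have "card T \<le> card (\<Union> ((\<lambda>a. F a - ?V) ` T))" if T: "T \<subseteq> A - S" for T
    proof -
      have finT: "finite T" using T fin finite_subset by blast
      have "card T + card S = card (T \<union> S)"
        using T finT finS by (subst card_Un_disjoint) auto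
      also have "\<dots> \<le> card (\<Union> (F ` (T \<union> S)))"
        using T SA by (intro hall) auto
      also have "\<Union> (F ` (T \<union> S)) = \<Union> ((\<lambda>a. F a - ?V) ` T) \<union> ?V"
        by auto
      also have "card \<dots> \<le> card (\<Union> ((\<lambda>a. F a - ?V) ` T)) + card ?V"
        by (rule card_Un_le)
      finally show ?thesis using tight(3) by linarith
    qed
    ultimately obtain g where g: "inj_on g (A - S)" "\<forall>a\<in>A - S. g a \<in> F a - ?V"
      using less.hyps[of "A - S" "\<lambda>a. F a - ?V"] fin finF by (metis DiffD1 finite_Diff)
    define h where "h a = (if a \<in> S then f a else g a)" for a
    have "inj_on h A"
    proof (rule inj_onI)
      fix x y assume xy: "x \<in> A" "y \<in> A" "h x = h y"
      have sep: "f s \<noteq> g t" if "s \<in> S" "t \<in> A - S" for s t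
        using f(2) g(2) that by fastforce
      show "x = y"
        using xy f(1) g(1) sep[of x y] sep[of y x]
        by (auto simp: h_def inj_on_def split: if_splits)
    qed
    moreover have "\<forall>a\<in>A. h a \<in> F a"
      using f(2) g(2) by (auto simp: h_def)
    ultimately show ?thesis by blast
  next
    case slack
    then obtain a where a: "a \<in> A" by blast
    have "card {a} \<le> card (F a)" using hall[of "{a}"] a by simp
    then obtain b where b: "b \<in> F a" by fastforce
    have "card (A - {a}) < card A"
      using a fin by (metis card_Diff1_less)
    \<comment> \<open>Deleting \<open>b\<close> costs at most one neighbour, which the strict
      inequality affords.\<close>
    moreover have "card T \<le> card (\<Union> ((\<lambda>c. F c - {b}) ` T))" if T: "T \<subseteq> A - {a}" for T
    proof (cases "T = {}")
      case False
      have "card T < card (\<Union> (F ` T))"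
        using T a False by (intro slack(2)) auto
      also have "card (\<Union> (F ` T)) \<le> Suc (card (\<Union> (F ` T) - {b}))"
        by (simp add: card_Diff_singleton_if le_SucI Suc_le_eq) linarith
      also have "\<Union> (F ` T) - {b} = \<Union> ((\<lambda>c. F c - {b}) ` T)" by auto
      finally show ?thesis by simp
    qed simp
    ultimately obtain g where g: "inj_on g (A - {a})" "\<forall>c\<in>A - {a}. g c \<in> F c - {b}"
      using less.hyps[of "A - {a}" "\<lambda>c. F c - {b}"] fin finF by (metis DiffD1 finite_Diff)
    have "inj_on (g(a := b)) A"
    proof (rule inj_onI)
      fix x y assume xy: "x \<in> A" "y \<in> A" "(g(a := b)) x = (g(a := b)) y"
      then show "x = y"
        using g by (cases "x = a"; cases "y = a") (auto simp: inj_on_def)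
    qed
    moreover have "\<forall>c\<in>A. (g(a := b)) c \<in> F c"
      using g(2) b by auto
    ultimately show ?thesis by blast
  qed
qed

section \<open>Multiples, progressions and extremal sumsets\<close>

lemma nat_multiple_0 [simp]: "nat_multiple 0 y = 0"
  by (simp add: nat_multiple_def)

lemma nat_multiple_Suc: "nat_multiple (Suc n) y = nat_multiple n y + y"
  by (simp add: nat_multiple_def)

lemma nat_multiple_mono: "y \<le> z \<Longrightarrow> nat_multiple n y \<le> nat_multiple n z"
  for y z :: "'a::linordered_ab_group_add"
  by (simp add: nat_multiple_def sum_mono)

lemma nat_multiple_le_iff:
  assumes "0 < (d::'a::linordered_ab_group_add)"
  shows "nat_multiple m d \<le> nat_multiple n d \<longleftrightarrow> m \<le> n"
proof -
  have "strict_mono (\<lambda>n. nat_multiple n d)"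
    using assms by (simp add: strict_mono_Suc_iff nat_multiple_Suc)
  then show ?thesis by (rule strict_mono_less_eq)
qed

text \<open>Translation by \<open>d\<close> sends \<open>E - {Max E}\<close> injectively into
  \<open>E - {Min E}\<close>. Both have the same size, so it is onto, and descending by
  \<open>d\<close> leads from any element to \<open>Min E\<close>: \<open>E\<close> lies in an
  arithmetic progression starting there.\<close>

lemma Max_of_shift_closed:
  fixes E :: "'a::linordered_ab_group_add set"
  assumes fin: "finite E" and ne: "E \<noteq> {}" and d: "0 < d"
    and closed: "\<And>z. \<lbrakk>z \<in> E; z \<noteq> Max E\<rbrakk> \<Longrightarrow> z + d \<in> E"
  shows "Min E + nat_multiple (card E - 1) d \<le> Max E"
proof -
  have sub: "(\<lambda>z. z + d) ` (E - {Max E}) \<subseteq> E - {Min E}"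
  proof (rule image_subsetI)
    fix z assume "z \<in> E - {Max E}"
    then have z: "z \<in> E" "z \<noteq> Max E" by auto
    have "Min E < z + d"
      using add_le_less_mono[OF Min_le[OF fin z(1)] d] by simp
    then show "z + d \<in> E - {Min E}" using closed z by auto
  qed
  have "card ((\<lambda>z. z + d) ` (E - {Max E})) = card (E - {Min E})"
    using fin ne by (subst card_image) auto
  then have shift: "(\<lambda>z. z + d) ` (E - {Max E}) = E - {Min E}"
    using sub fin by (intro card_subset_eq) auto
  have prog: "\<exists>i. z = Min E + nat_multiple i d" if "z \<in> E" for z
    using that
  proof (induction "card {w \<in> E. w < z}" arbitrary: z rule: less_induct)
    case less
    show ?case
    proof (cases "z = Min E")
      case True
      then have "z = Min E + nat_multiple 0 d" by simp
      then show ?thesis by blast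
    next
      case False
      then obtain w where w: "w \<in> E" "z = w + d"
        using less.prems shift by (metis (no_types, lifting) DiffD1 DiffI image_iff singletonD)
      then have "{v \<in> E. v < w} \<subset> {v \<in> E. v < z}"
        using d less_trans[of _ w z] by (intro psubsetI) auto
      then have "card {v \<in> E. v < w} < card {v \<in> E. v < z}"
        using fin by (intro psubset_card_mono) auto
      then obtain i where "w = Min E + nat_multiple i d"
        using less.hyps w(1) by blast
      then have "z = Min E + nat_multiple (Suc i) d"
        using w(2) by (simp add: nat_multiple_Suc add.assoc)
      then show ?thesis by blast
    qed
  qed
  obtain k where k: "Max E = Min E + nat_multiple k d"
    using prog Max_in[OF fin ne] by blast
  \<comment> \<open>No index exceeds \<open>k\<close>, so \<open>E\<close> has at most
    \<open>k + 1\<close> elements; the \<open>- 1\<close> in the conclusion accounts for index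
    0.\<close>
  have "E \<subseteq> (\<lambda>i. Min E + nat_multiple i d) ` {..k}"
  proof
    fix z assume z: "z \<in> E"
    then obtain i where i: "z = Min E + nat_multiple i d" using prog by blast
    then have "nat_multiple i d \<le> nat_multiple k d"
      using Max_ge[OF fin z] k by simp
    then show "z \<in> (\<lambda>i. Min E + nat_multiple i d) ` {..k}"
      using i d by (simp add: nat_multiple_le_iff)
  qed
  then have "card E \<le> card {..k}"
    by (meson card_image_le card_mono finite_atMost finite_imageI le_trans)
  then show ?thesis
    using d by (simp add: k nat_multiple_le_iff)
qed

text \<open>The equality case of \<open>|S + ({0} \<union> U)| \<ge> |S| + |U|\<close>: each of the two monotone paths in the
  grid \<open>S \<times> ({0} \<union> U)\<close> that run along two of its sides already fills \<open>E\<close>.\<close>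

lemma Max_of_extremal_sumset:
  fixes E S U :: "'a::linordered_ab_group_add set"
  assumes finE: "finite E" and SE: "S \<subseteq> E" and S2: "2 \<le> card S"
    and finU: "finite U" and U: "U \<noteq> {}" and pos: "\<And>u. u \<in> U \<Longrightarrow> 0 < u"
    and sums: "\<And>s u. \<lbrakk>s \<in> S; u \<in> U\<rbrakk> \<Longrightarrow> s + u \<in> E"
    and card: "card E \<le> card S + card U"
  shows "Min E + nat_multiple (card E - 1) (Min U) \<le> Max E"
proof -
  define d where "d = Min U"
  define m where "m = Max S"
  define l where "l = Min S"
  define t where "t = Max U"
  have finS: "finite S" using SE finE finite_subset by blast
  have S: "S \<noteq> {}" using S2 by auto
  have dU: "d \<in> U" and tU: "t \<in> U" and mS: "m \<in> S" and lS: "l \<in> S"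
    unfolding d_def t_def m_def l_def using finU U finS S by auto
  have d_le: "d \<le> u" and le_t: "u \<le> t" if "u \<in> U" for u
    unfolding d_def t_def using that finU by auto
  have le_m: "s \<le> m" and l_le: "l \<le> s" if "s \<in> S" for s
    unfolding m_def l_def using that finS by auto
  have d: "0 < d" and t: "0 < t" using pos dU tU by auto
  \<comment> \<open>First path: through \<open>S\<close> up to \<open>m\<close>, then through
    \<open>m + U\<close>. The halves are disjoint because \<open>s \<le> m < m + u\<close>.\<close>
  have "card (S \<union> (\<lambda>u. m + u) ` U) = card S + card U"
  proof (subst card_Un_disjoint)
    show "S \<inter> (\<lambda>u. m + u) ` U = {}"
      using le_m pos by (fastforce simp: not_le[symmetric])
  qed (use finS finU in \<open>auto simp: card_image\<close>)
  then have E1: "E = S \<union> (\<lambda>u. m + u) ` U"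
    using card finE SE sums mS by (intro card_seteq[symmetric]) auto
  \<comment> \<open>Since \<open>s + d < m + d \<le> m + u\<close>, the element \<open>s + d\<close>
    of \<open>E\<close> misses the second half of the path.\<close>
  have step: "s + d \<in> S" if "s \<in> S" "s \<noteq> m" for s
  proof -
    have "s + d \<noteq> m + u" if "u \<in> U" for u
      using add_less_le_mono[of s m d u] le_m[OF \<open>s \<in> S\<close>] \<open>s \<noteq> m\<close> d_le[OF that]
      by (auto simp: less_le)
    moreover have "s + d \<in> E" using sums dU that by blast
    ultimately show ?thesis using E1 by blast
  qed
  have "l \<noteq> m"
  proof
    assume "l = m"
    then have "S \<subseteq> {l}" using le_m l_le by force
    then have "card S \<le> card {l}" by (intro card_mono) auto
    then show False using S2 by simp
  qed
  \<comment> \<open>Second path: \<open>P\<close> climbs from \<open>l\<close> to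
    \<open>l + t\<close>, and \<open>Q\<close> continues strictly above. Leaving \<open>l\<close>
    out of \<open>Q\<close> avoids counting the corner \<open>l + t\<close> twice.\<close>
  define P where "P = insert l ((\<lambda>u. l + u) ` U)"
  define Q where "Q = (\<lambda>s. s + t) ` (S - {l})"
  have P_le: "x \<le> l + t" if "x \<in> P" for x
    using that t le_t by (auto simp: P_def)
  have Q_gt: "l + t < x" if "x \<in> Q" for x
    using that l_le by (force simp: Q_def)
  have finPQ: "finite P" "finite Q"
    using finU finS by (auto simp: P_def Q_def)
  have "l \<notin> (\<lambda>u. l + u) ` U" using pos by fastforce
  then have "card P = Suc (card U)"
    using finU by (simp add: P_def card_image)
  moreover have "card Q = card S - 1"
    using finS lS by (simp add: Q_def card_image inj_on_def)
  moreover have "P \<inter> Q = {}" using P_le Q_gt by (fastforce simp: not_le[symmetric])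
  ultimately have "card (P \<union> Q) = card S + card U"
    using S2 finPQ by (simp add: card_Un_disjoint)
  moreover have "P \<union> Q \<subseteq> E"
    using SE sums lS tU by (auto simp: P_def Q_def)
  ultimately have E2: "E = P \<union> Q"
    using card finE by (intro card_seteq[symmetric]) auto
  have Max: "Max E = m + t"
  proof (rule Max_eqI[OF finE])
    show "m + t \<in> E" using sums mS tU by blast
    show "z \<le> m + t" if "z \<in> E" for z
    proof (cases "z \<in> P")
      case True
      then show ?thesis using P_le[OF True] le_m[OF lS] by (meson add_right_mono order_trans)
    next
      case False
      then show ?thesis using that E2 le_m by (auto simp: Q_def)
    qed
  qed
  have "Min E + nat_multiple (card E - 1) d \<le> Max E"
  proof (rule Max_of_shift_closed[OF finE _ d])
    show "E \<noteq> {}" using SE S by auto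
    fix z assume z: "z \<in> E" "z \<noteq> Max E"
    \<comment> \<open>Along the second path, \<open>l + d\<close> is a sum already. Elsewhere
      \<open>step\<close> absorbs \<open>d\<close> into the summand from \<open>S\<close>; this
      fails only for \<open>s = m\<close>, where \<open>z\<close> is the maximum.\<close>
    consider "z = l" | u where "u \<in> U" "z = l + u" | s where "s \<in> S" "z = s + t"
      using z(1) E2 by (auto simp: P_def Q_def)
    then show "z + d \<in> E"
    proof cases
      case 1
      then show ?thesis using sums lS dU by blast
    next
      case 2
      have "(l + d) + u \<in> E" using sums step[OF lS \<open>l \<noteq> m\<close>] 2(1) by blast
      then show ?thesis by (simp add: 2(2) ac_simps)
    next
      case 3
      then have "s \<noteq> m" using z(2) Max by auto
      then have "(s + d) + t \<in> E" using sums[OF step[OF 3(1)] tU] by simp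
      then show ?thesis by (simp add: 3(2) ac_simps)
    qed
  qed
  then show ?thesis by (simp add: d_def)
qed

section \<open>Hall's condition for the relation \<open>a + b \<notin> E\<close>\<close>

text \<open>The bound \<open>y\<close> need not lie in \<open>B\<close>, so the minimum of a larger
  ground set can be used. The excluded value of \<open>B\<close> is the one for which
  \<open>{Min E}\<close> may violate Hall's condition.\<close>

lemma ex_matching_avoiding:
  fixes E A B :: "'a::linordered_ab_group_add set"
  assumes finE: "finite E" and posE: "\<And>x. x \<in> E \<Longrightarrow> 0 < x"
    and AE: "A \<subseteq> E" and cA: "card E = Suc (card A)"
    and finB: "finite B" and cB: "card B = card A"
    and posB: "\<And>b. b \<in> B \<Longrightarrow> 0 < b"
    and y: "\<And>b. b \<in> B \<Longrightarrow> y \<le> b" "Max E \<le> nat_multiple (card A) y"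
    and exceptional: "B \<noteq> (\<lambda>x. x - Min E) ` (E - {Min E})"
  shows "\<exists>f. bij_betw f A B \<and> (\<forall>a\<in>A. a + f a \<notin> E)"
proof -
  define F where "F a = {b \<in> B. a + b \<notin> E}" for a
  have finA: "finite A" using AE finE finite_subset by blast
  have ne: "E \<noteq> {}" using cA by auto
  have "card S \<le> card (\<Union> (F ` S))" if SA: "S \<subseteq> A" for S
  proof (rule ccontr)
    assume viol: "\<not> card S \<le> card (\<Union> (F ` S))"
    \<comment> \<open>\<open>U\<close> collects the elements of \<open>B\<close> joined to nothing
      in \<open>S\<close>. Fewer than \<open>card S\<close> elements are removed from
      \<open>B\<close>, so \<open>card S + card U\<close> exceeds \<open>card A\<close>.\<close>
    define U where "U = B - \<Union> (F ` S)"
    have finS: "finite S" using SA finA finite_subset by blast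
    have UB: "U \<subseteq> B" and finU: "finite U" using finB by (auto simp: U_def)
    have sums: "s + u \<in> E" if "s \<in> S" "u \<in> U" for s u
      using that by (auto simp: U_def F_def)
    have "\<Union> (F ` S) \<subseteq> B" by (auto simp: F_def)
    then have cU: "card U = card A - card (\<Union> (F ` S))" "card (\<Union> (F ` S)) \<le> card A"
      using finB cB by (auto simp: U_def card_Diff_subset finite_subset card_mono simp flip: cB)
    have SU: "card E \<le> card S + card U" using cU viol cA by linarith
    have "card S \<le> card A" using SA finA card_mono by blast
    then have U: "U \<noteq> {}" using SU cA by force
    show False
    proof (cases "2 \<le> card S")
      case True
      have "nat_multiple (card A) y \<le> nat_multiple (card A) (Min U)"
        using y(1) UB finU U by (intro nat_multiple_mono) auto
      also have "\<dots> < Min E + nat_multiple (card A) (Min U)"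
        using posE finE ne by simp
      also have "\<dots> \<le> Max E"
        using Max_of_extremal_sumset[OF finE _ True finU U _ sums SU] SA AE UB posB cA by auto
      finally show False using y(2) by simp
    next
      case False
      \<comment> \<open>A single \<open>s\<close> forces \<open>U = B\<close> by counting. Then
        \<open>s\<close> and \<open>s + B\<close> fill \<open>E\<close>, with \<open>s\<close> as
        its minimum, so \<open>B\<close> has the excluded value.\<close>
      then have S1: "card S = 1" using viol by linarith
      then obtain s where s: "S = {s}" by (auto simp: card_1_singleton_iff)
      have "U = B" using SU S1 cA cB finB UB by (intro card_seteq) auto
      have "s \<notin> (\<lambda>b. s + b) ` B" using posB by fastforce
      then have "card (insert s ((\<lambda>b. s + b) ` B)) = card E"
        using finB cB cA by (simp add: card_image)
      then have E: "E = insert s ((\<lambda>b. s + b) ` B)"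
        using finE SA AE s sums \<open>U = B\<close> by (intro card_subset_eq[symmetric]) auto
      have "Min E = s"
        using finE by (intro Min_eqI) (use E posB in \<open>auto simp: less_imp_le\<close>)
      then have "E - {Min E} = (\<lambda>b. s + b) ` B"
        using E \<open>s \<notin> (\<lambda>b. s + b) ` B\<close> by auto
      then show False
        using exceptional \<open>Min E = s\<close> by (simp add: image_image)
    qed
  qed
  then obtain f where f: "inj_on f A" "\<forall>a\<in>A. f a \<in> F a"
    using hall_marriage[of A F] finA finB by (auto simp: F_def)
  have "f ` A = B"
    using f finB cB by (intro card_subset_eq) (auto simp: card_image F_def)
  then show ?thesis
    using f by (auto simp: bij_betw_def F_def)
qed

section \<open>Bases of matroids\<close>

lemma indep_card_le_rank:
  assumes "matroid M" "I \<in> indeps M"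
  shows "card I \<le> matroid_rank M"
proof -
  have "finite (indeps M)"
    using assms(1) by (meson finite_Pow_iff finite_subset matroid_def)
  then show ?thesis using assms(2) by (simp add: matroid_rank_def)
qed

text \<open>A basis is maximal for inclusion only; exchange with an independent set of maximum size
  turns this into maximality of size.\<close>

lemma card_basis:
  assumes M: "matroid M" and A: "basis M A"
  shows "card A = matroid_rank M"
proof (rule ccontr)
  assume "card A \<noteq> matroid_rank M"
  moreover have A': "A \<in> indeps M" using A by (simp add: basis_def)
  ultimately have "card A < matroid_rank M"
    using indep_card_le_rank[OF M A'] by simp
  moreover have "finite (indeps M)"
    using M by (meson finite_Pow_iff finite_subset matroid_def)
  then have "matroid_rank M \<in> card ` indeps M"
    unfolding matroid_rank_def using A' by (intro Max_in) auto
  ultimately obtain J where J: "J \<in> indeps M" "card A < card J" by auto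
  have "\<forall>I\<in>indeps M. \<forall>J\<in>indeps M. card I < card J \<longrightarrow> (\<exists>e\<in>J - I. insert e I \<in> indeps M)"
    using M by (simp add: matroid_def)
  then obtain e where e: "e \<in> J - A" "insert e A \<in> indeps M"
    using A' J by meson
  moreover have "insert e A = A"
    using A e(2) by (simp add: basis_def subset_insertI)
  ultimately show False by auto
qed

lemma indep_extends_to_basis:
  assumes M: "matroid M" and I: "I \<in> indeps M"
  obtains B where "basis M B" "I \<subseteq> B"
proof -
  have "finite (indeps M)"
    using M by (meson finite_Pow_iff finite_subset matroid_def)
  from finite_has_maximal2[OF this I] obtain B
    where B: "B \<in> indeps M" "I \<subseteq> B" "\<forall>J\<in>indeps M. B \<subseteq> J \<longrightarrow> B = J"
    by blast
  have "basis M B" using B(1,3) by (auto simp: basis_def)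
  then show ?thesis using B(2) by (rule that)
qed

text \<open>By size, a basis misses some \<open>e\<close>. As \<open>e\<close> is not a loop, it
  extends to a basis, necessarily a different one.\<close>

lemma loopless_two_bases:
  assumes N: "matroid N" and "loopless N" and "matroid_rank N < card (ground N)"
  obtains B C where "basis N B" "basis N C" "B \<noteq> C"
proof -
  have empty: "{} \<in> indeps N" using N by (simp add: matroid_def)
  then obtain B where B: "basis N B" by (rule indep_extends_to_basis[OF N])
  then have "B \<subseteq> ground N" using N by (auto simp: basis_def matroid_def)
  moreover have "B \<noteq> ground N" using card_basis[OF N B] assms(3) by auto
  ultimately obtain e where e: "e \<in> ground N" "e \<notin> B" by blast
  then have "\<not> circuit N {e}" using assms(2) by (simp add: loopless_def)
  then have "{e} \<in> indeps N"
    using e(1) empty unfolding circuit_def by (auto simp: psubset_eq subset_singleton_iff)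
  then obtain C where "basis N C" "{e} \<subseteq> C" by (rule indep_extends_to_basis[OF N])
  then show ?thesis using that B e(2) by blast
qed

theorem theorem3p2:
  fixes M N :: "'g::linordered_ab_group_add set_system"
    and n :: nat
  assumes "torsion_free TYPE('g)"
    and "matroid M" and "matroid N"
    and "loopless M" and "loopless N"
    and "matroid_rank M = n" and "matroid_rank N = n" and "n \<ge> 1"
    and "positive_set (ground M)" and "positive_set (ground N)"
    and "sparse_paving N"
    and "card (ground M) = n + 1" and "card (ground N) = n + 1"
    and "Max (ground M) \<le> nat_multiple n (Min (ground N))"
  shows "matched_to M N"
proof -
  let ?E = "ground M"
  have finE: "finite ?E" and finN: "finite (ground N)"
    using assms(2,3) by (auto simp: matroid_def)
  have posE: "0 < x" if "x \<in> ?E" for x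
    using assms(9) that by (auto simp: positive_set_def less_le)
  obtain B1 B2 where "basis N B1" "basis N B2" "B1 \<noteq> B2"
    using loopless_two_bases[OF assms(3,5)] assms(7,13) by auto
  \<comment> \<open>The excluded set depends on \<open>M\<close> only through its ground set, so one
    \<open>B\<close> serves every basis \<open>A\<close>.\<close>
  then obtain B where B: "basis N B" "B \<noteq> (\<lambda>x. x - Min ?E) ` (?E - {Min ?E})"
    by metis
  have BN: "B \<subseteq> ground N" using B(1) assms(3) by (auto simp: basis_def matroid_def)
  have cB: "card B = n" using card_basis[OF assms(3) B(1)] assms(7) by simp
  show ?thesis
    unfolding matched_to_def
  proof (intro allI impI)
    fix A assume A: "basis M A"
    have AE: "A \<subseteq> ?E" using A assms(2) by (auto simp: basis_def matroid_def)
    have cA: "card A = n" using card_basis[OF assms(2) A] assms(6) by simp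
    obtain f where f: "bij_betw f A B" "\<forall>a\<in>A. a + f a \<notin> ?E"
    proof (rule exE[OF ex_matching_avoiding[OF finE posE AE, of B "Min (ground N)"]])
      show "0 < b" if "b \<in> B" for b
        using assms(10) BN that by (auto simp: positive_set_def less_le)
      show "Min (ground N) \<le> b" if "b \<in> B" for b
        using BN finN that by auto
    qed (use B(2) cA cB assms(12,14) finite_subset[OF BN finN] in auto)
    obtain a where a: "bij_betw a {1..n} A"
      using ex_bij_betw_nat_finite_1[OF finite_subset[OF AE finE]] cA by auto
    \<comment> \<open>Any ordering of \<open>A\<close> will do; \<open>f\<close> carries it over to
      \<open>B\<close>.\<close>
    have "bij_betw (f \<circ> a) {1..n} B" using bij_betw_trans[OF a f(1)] .
    moreover have "matched_bases M n a (f \<circ> a)"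
      using f(2) bij_betwE[OF a] by (auto simp: matched_bases_def)
    ultimately show "\<exists>B a b. basis N B \<and> bij_betw a {1..matroid_rank M} A \<and>
        bij_betw b {1..matroid_rank N} B \<and> matched_bases M (matroid_rank M) a b"
      using B(1) a assms(6,7) by auto
  qed
qed

end
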